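(* Let $A$ be a Banach algebra, $X$ a Banach $A$-bimodule and $D:A\to X^*$ a surjective derivation. Suppose that $D'':A^{**}\to X^{***}$ is also a derivation. Then for every $x''\in X^{**}$ the mapping $a''\mapsto x''a''$ from $A^{**}$ to $X^{**}$ is weak$^*$-to-weak continuous.
   Context: A derivation from a Banach algebra $B$ into a Banach $B$-bimodule $Y$ is a bounded linear map $D$ with $D(xy)=xD(y)+D(x)y$ for all $x,y\in B$. The dual $Y^*$ of a Banach $B$-bimodule $Y$ is a $B$-bimodule via $\langle by',y\rangle=\langle y',yb\rangle$, $\langle y'b,y\rangle=\langle y',by\rangle$. $D''$ is the second adjoint of $D$. $A^{**}$ carries the first Arens product: $\langle b''a',a\rangle=\langle b'',a'a\rangle$ and $\langle a''b'',a'\rangle=\langle a'',b''a'\rangle$, where $\langle a'a,b\rangle=\langle a',ab\rangle$. $X^{**}$ is a Banach $A^{**}$-bimodule via $a''x''=w^*\text{-}\lim_i\lim_j a_ix_j$ and $x''a''=w^*\text{-}\lim_j\lim_i x_ja_i$, for nets $(a_i)\subseteq A$, $(x_j)\subseteq X$ converging weak$^*$ to $a''$, $x''$ (iterated weak$^*$ limits, the inner limit being taken first). $X^{***}$ is the dual $A^{**}$-bimodule of $X^{**}$. *)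

theory Defs
  imports "HOL-Analysis.Analysis"
begin

text \<open>
  Banach algebras and bimodules are treated over both scalar fields. Over the reals the dual of
  \<open>'a\<close> is \<open>'a \<Rightarrow>\<^sub>L real\<close>, and its weak* topology is the library's \<open>strong_operator_topology\<close>.
  Over the complex numbers, complex normed spaces and their duals \<open>'a cdual\<close> are introduced below.
  Constants with the prefix \<open>c\<close> are the complex versions. Algebras are not assumed unital.
\<close>

section \<open>Notions independent of the scalar field\<close>

definition bimodule_laws :: "('a::times \<Rightarrow> 'x \<Rightarrow> 'x) \<Rightarrow> ('x \<Rightarrow> 'a \<Rightarrow> 'x) \<Rightarrow> bool" where
  "bimodule_laws l r \<longleftrightarrow>
     (\<forall>a b x. l (a * b) x = l a (l b x)) \<and>
     (\<forall>a b x. r x (a * b) = r (r x a) b) \<and>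
     (\<forall>a b x. r (l a x) b = l a (r x b))"

text \<open>
  The multiplication \<open>m\<close> is an argument, since the bidual of an algebra carries its Arens product
  and not a type class multiplication.
\<close>

definition leibniz ::
  "('b \<Rightarrow> 'b \<Rightarrow> 'b) \<Rightarrow> ('b \<Rightarrow> 'y \<Rightarrow> 'y) \<Rightarrow> ('y \<Rightarrow> 'b \<Rightarrow> 'y) \<Rightarrow> ('b \<Rightarrow> 'y::plus) \<Rightarrow> bool" where
  "leibniz m l r D \<longleftrightarrow> (\<forall>x y. D (m x y) = l x (D y) + r (D x) y)"

text \<open>\<open>z\<close> is the limit along \<open>F\<close> of the limits along \<open>G\<close> (inner limit first).\<close>

definition iterated_limit ::
  "'z topology \<Rightarrow> ('i \<Rightarrow> 'j \<Rightarrow> 'z) \<Rightarrow> 'z \<Rightarrow> 'i filter \<Rightarrow> 'j filter \<Rightarrow> bool" where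
  "iterated_limit T f z F G \<longleftrightarrow>
     (\<exists>u. (\<forall>\<^sub>F i in F. limitin T (f i) (u i) G) \<and> limitin T u z F)"


section \<open>Real scalars\<close>

definition banach_bimodule ::
  "('a::{real_normed_algebra,banach} \<Rightarrow> 'x::banach \<Rightarrow> 'x) \<Rightarrow> ('x \<Rightarrow> 'a \<Rightarrow> 'x) \<Rightarrow> bool" where
  "banach_bimodule l r \<longleftrightarrow> bounded_bilinear l \<and> bounded_bilinear r \<and> bimodule_laws l r"

definition derivation ::
  "('b::real_normed_vector \<Rightarrow> 'b \<Rightarrow> 'b) \<Rightarrow> ('b \<Rightarrow> 'y::real_normed_vector \<Rightarrow> 'y) \<Rightarrow>
   ('y \<Rightarrow> 'b \<Rightarrow> 'y) \<Rightarrow> ('b \<Rightarrow> 'y) \<Rightarrow> bool" where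
  "derivation m l r D \<longleftrightarrow> bounded_linear D \<and> leibniz m l r D"

text \<open>The dual left action comes from the right action of the module, and vice versa.\<close>

definition dual_lact ::
  "('y::real_normed_vector \<Rightarrow> 'b \<Rightarrow> 'y) \<Rightarrow> 'b \<Rightarrow> ('y \<Rightarrow>\<^sub>L real) \<Rightarrow> ('y \<Rightarrow>\<^sub>L real)" where
  "dual_lact r b f = Blinfun (\<lambda>y. blinfun_apply f (r y b))"

definition dual_ract ::
  "('b \<Rightarrow> 'y::real_normed_vector \<Rightarrow> 'y) \<Rightarrow> ('y \<Rightarrow>\<^sub>L real) \<Rightarrow> 'b \<Rightarrow> ('y \<Rightarrow>\<^sub>L real)" where
  "dual_ract l f b = Blinfun (\<lambda>y. blinfun_apply f (l b y))"

definition adjoint_map ::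
  "('v::real_normed_vector \<Rightarrow> 'w::real_normed_vector) \<Rightarrow> ('w \<Rightarrow>\<^sub>L real) \<Rightarrow> ('v \<Rightarrow>\<^sub>L real)" where
  "adjoint_map T f = Blinfun (\<lambda>v. blinfun_apply f (T v))"

definition canon :: "'v::real_normed_vector \<Rightarrow> ('v \<Rightarrow>\<^sub>L real) \<Rightarrow>\<^sub>L real" where
  "canon v = Blinfun (\<lambda>f. blinfun_apply f v)"

abbreviation weak_star :: "('v::real_normed_vector \<Rightarrow>\<^sub>L real) topology" where
  "weak_star \<equiv> strong_operator_topology"

definition weak_topology :: "'v::real_normed_vector topology" where
  "weak_topology = pullback_topology UNIV (\<lambda>v f. blinfun_apply (f :: 'v \<Rightarrow>\<^sub>L real) v) euclidean"

definition arens_left ::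
  "(('a::real_normed_algebra \<Rightarrow>\<^sub>L real) \<Rightarrow>\<^sub>L real) \<Rightarrow> ('a \<Rightarrow>\<^sub>L real) \<Rightarrow> ('a \<Rightarrow>\<^sub>L real)" where
  "arens_left G f = Blinfun (\<lambda>a. blinfun_apply G (dual_ract (*) f a))"

definition arens_mult ::
  "(('a::real_normed_algebra \<Rightarrow>\<^sub>L real) \<Rightarrow>\<^sub>L real) \<Rightarrow> (('a \<Rightarrow>\<^sub>L real) \<Rightarrow>\<^sub>L real) \<Rightarrow>
   (('a \<Rightarrow>\<^sub>L real) \<Rightarrow>\<^sub>L real)" where
  "arens_mult F G = Blinfun (\<lambda>f. blinfun_apply F (arens_left G f))"

text \<open>
  Nets in \<open>'a\<close> and \<open>'x\<close> are represented by proper filters on \<open>'a\<close> and \<open>'x\<close> (the image of the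
  section filter of the net). The limits below do not depend on the filters \<open>F\<close>, \<open>G\<close>, and such
  filters exist because the canonical image of a space is weak* dense in its bidual; so the
  descriptions are proper when \<open>l\<close> and \<open>r\<close> are bounded bilinear.
\<close>

definition bidual_lact ::
  "('a::real_normed_vector \<Rightarrow> 'x::real_normed_vector \<Rightarrow> 'x) \<Rightarrow>
   (('a \<Rightarrow>\<^sub>L real) \<Rightarrow>\<^sub>L real) \<Rightarrow> (('x \<Rightarrow>\<^sub>L real) \<Rightarrow>\<^sub>L real) \<Rightarrow> (('x \<Rightarrow>\<^sub>L real) \<Rightarrow>\<^sub>L real)" where
  "bidual_lact l a'' x'' = (THE z. \<forall>F G. F \<noteq> bot \<longrightarrow> G \<noteq> bot \<longrightarrow>
      limitin weak_star canon a'' F \<longrightarrow> limitin weak_star canon x'' G \<longrightarrow>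
      iterated_limit weak_star (\<lambda>a x. canon (l a x)) z F G)"

definition bidual_ract ::
  "('x::real_normed_vector \<Rightarrow> 'a::real_normed_vector \<Rightarrow> 'x) \<Rightarrow>
   (('x \<Rightarrow>\<^sub>L real) \<Rightarrow>\<^sub>L real) \<Rightarrow> (('a \<Rightarrow>\<^sub>L real) \<Rightarrow>\<^sub>L real) \<Rightarrow> (('x \<Rightarrow>\<^sub>L real) \<Rightarrow>\<^sub>L real)" where
  "bidual_ract r x'' a'' = (THE z. \<forall>F G. F \<noteq> bot \<longrightarrow> G \<noteq> bot \<longrightarrow>
      limitin weak_star canon a'' F \<longrightarrow> limitin weak_star canon x'' G \<longrightarrow>
      iterated_limit weak_star (\<lambda>x a. canon (r x a)) z G F)"


section \<open>Complex normed spaces and their duals\<close>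

class complex_normed_vector = real_normed_vector +
  fixes scaleC :: "complex \<Rightarrow> 'a \<Rightarrow> 'a"  (infixr "*\<^sub>C" 75)
  assumes scaleC_add_right: "c *\<^sub>C (x + y) = c *\<^sub>C x + c *\<^sub>C y"
    and scaleC_add_left: "(c + d) *\<^sub>C x = c *\<^sub>C x + d *\<^sub>C x"
    and scaleC_scaleC: "c *\<^sub>C (d *\<^sub>C x) = (c * d) *\<^sub>C x"
    and scaleC_of_real: "complex_of_real t *\<^sub>C x = t *\<^sub>R x"
    and norm_scaleC: "norm (c *\<^sub>C x) = cmod c * norm x"

class complex_normed_algebra = complex_normed_vector + real_normed_algebra +
  assumes mult_scaleC_left: "(c *\<^sub>C x) * y = c *\<^sub>C (x * y)"
    and mult_scaleC_right: "x * (c *\<^sub>C y) = c *\<^sub>C (x * y)"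

typedef (overloaded) 'a cdual =
  "{f :: 'a::complex_normed_vector \<Rightarrow>\<^sub>L complex. \<forall>c x. blinfun_apply f (c *\<^sub>C x) = c * blinfun_apply f x}"
  morphisms blinfun_of_cdual cdual_of_blinfun
  by (rule exI[of _ 0]) simp

setup_lifting type_definition_cdual

lift_definition cdual_apply :: "'a::complex_normed_vector cdual \<Rightarrow> 'a \<Rightarrow> complex"
  is blinfun_apply .

text \<open>Meaningful for bounded complex linear functions only, in analogy with \<open>Blinfun\<close>.\<close>

definition Cdual :: "('a::complex_normed_vector \<Rightarrow> complex) \<Rightarrow> 'a cdual" where
  "Cdual f = cdual_of_blinfun (Blinfun f)"

instantiation cdual :: (complex_normed_vector) complex_normed_vector
begin

lift_definition zero_cdual :: "'a cdual" is 0 by simp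
lift_definition plus_cdual :: "'a cdual \<Rightarrow> 'a cdual \<Rightarrow> 'a cdual" is "(+)"
  by (simp add: blinfun.add_left algebra_simps)
lift_definition minus_cdual :: "'a cdual \<Rightarrow> 'a cdual \<Rightarrow> 'a cdual" is "(-)"
  by (simp add: blinfun.diff_left algebra_simps)
lift_definition uminus_cdual :: "'a cdual \<Rightarrow> 'a cdual" is uminus
  by (simp add: blinfun.minus_left)
lift_definition scaleR_cdual :: "real \<Rightarrow> 'a cdual \<Rightarrow> 'a cdual" is scaleR
  by (simp add: blinfun.scaleR_left)
lift_definition scaleC_cdual :: "complex \<Rightarrow> 'a cdual \<Rightarrow> 'a cdual"
  is "\<lambda>c f. blinfun_compose (blinfun_mult_right c) f"
  by (simp add: algebra_simps)
lift_definition norm_cdual :: "'a cdual \<Rightarrow> real" is norm .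

definition sgn_cdual :: "'a cdual \<Rightarrow> 'a cdual" where
  "sgn_cdual f = inverse (norm f) *\<^sub>R f"
definition dist_cdual :: "'a cdual \<Rightarrow> 'a cdual \<Rightarrow> real" where
  "dist_cdual f g = norm (f - g)"
definition uniformity_cdual :: "('a cdual \<times> 'a cdual) filter" where
  "uniformity_cdual = (INF e\<in>{0 <..}. principal {(f, g). dist f g < e})"
definition open_cdual :: "'a cdual set \<Rightarrow> bool" where
  "open_cdual S \<longleftrightarrow> (\<forall>f\<in>S. \<forall>\<^sub>F (f', g) in uniformity. f' = f \<longrightarrow> g \<in> S)"

instance
proof
  fix f g h :: "'a cdual" and s t :: real and c d :: complex
  show "f + g + h = f + (g + h)" "f + g = g + f" "0 + f = f" "- f + f = 0" "f - g = f + - g"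
    by (transfer; simp)+
  show "s *\<^sub>R (f + g) = s *\<^sub>R f + s *\<^sub>R g" "(s + t) *\<^sub>R f = s *\<^sub>R f + t *\<^sub>R f"
    "s *\<^sub>R t *\<^sub>R f = (s * t) *\<^sub>R f" "1 *\<^sub>R f = f"
    by (transfer; simp add: scaleR_add_right scaleR_add_left)+
  show "(norm f = 0) = (f = 0)" "norm (f + g) \<le> norm f + norm g" "norm (s *\<^sub>R f) = \<bar>s\<bar> * norm f"
    by (transfer; simp add: norm_triangle_ineq)+
  show "c *\<^sub>C (f + g) = c *\<^sub>C f + c *\<^sub>C g" "(c + d) *\<^sub>C f = c *\<^sub>C f + d *\<^sub>C f"
    "c *\<^sub>C d *\<^sub>C f = (c * d) *\<^sub>C f" "complex_of_real t *\<^sub>C f = t *\<^sub>R f"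
    by (transfer; rule blinfun_eqI; simp add: blinfun.add_left blinfun.scaleR_left
        algebra_simps scaleR_conv_of_real)+
  have le: "norm (k *\<^sub>C g) \<le> cmod k * norm g" for k and g :: "'a cdual"
    by transfer (auto intro!: norm_blinfun_bound mult_left_mono norm_blinfun simp: norm_mult mult.assoc)
  have "cmod c * norm f \<le> norm (c *\<^sub>C f)" if "c \<noteq> 0"
  proof -
    have "inverse c *\<^sub>C c *\<^sub>C f = f"
      using that by (transfer; intro blinfun_eqI; simp)
    with le[of "inverse c" "c *\<^sub>C f"] that show ?thesis
      by (simp add: norm_inverse norm_divide field_simps)
  qed
  moreover have "cmod c * norm f \<le> norm (c *\<^sub>C f)" if "c = 0"
    using that by (transfer; simp)
  ultimately show "norm (c *\<^sub>C f) = cmod c * norm f"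
    using le[of c f] by (cases "c = 0") auto
qed (simp_all add: sgn_cdual_def dist_cdual_def uniformity_cdual_def open_cdual_def)

end


section \<open>Complex scalars\<close>

definition bounded_clinear ::
  "('v::complex_normed_vector \<Rightarrow> 'w::complex_normed_vector) \<Rightarrow> bool" where
  "bounded_clinear T \<longleftrightarrow> bounded_linear T \<and> (\<forall>c v. T (c *\<^sub>C v) = c *\<^sub>C T v)"

definition bounded_cbilinear ::
  "('u::complex_normed_vector \<Rightarrow> 'v::complex_normed_vector \<Rightarrow> 'w::complex_normed_vector) \<Rightarrow> bool" where
  "bounded_cbilinear B \<longleftrightarrow> bounded_bilinear B \<and>
     (\<forall>c u v. B (c *\<^sub>C u) v = c *\<^sub>C B u v) \<and> (\<forall>c u v. B u (c *\<^sub>C v) = c *\<^sub>C B u v)"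

definition cbanach_bimodule ::
  "('a::{complex_normed_algebra,banach} \<Rightarrow> 'x::{complex_normed_vector,banach} \<Rightarrow> 'x) \<Rightarrow>
   ('x \<Rightarrow> 'a \<Rightarrow> 'x) \<Rightarrow> bool" where
  "cbanach_bimodule l r \<longleftrightarrow> bounded_cbilinear l \<and> bounded_cbilinear r \<and> bimodule_laws l r"

definition cderivation ::
  "('b::complex_normed_vector \<Rightarrow> 'b \<Rightarrow> 'b) \<Rightarrow> ('b \<Rightarrow> 'y::complex_normed_vector \<Rightarrow> 'y) \<Rightarrow>
   ('y \<Rightarrow> 'b \<Rightarrow> 'y) \<Rightarrow> ('b \<Rightarrow> 'y) \<Rightarrow> bool" where
  "cderivation m l r D \<longleftrightarrow> bounded_clinear D \<and> leibniz m l r D"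

definition cdual_lact ::
  "('y::complex_normed_vector \<Rightarrow> 'b \<Rightarrow> 'y) \<Rightarrow> 'b \<Rightarrow> 'y cdual \<Rightarrow> 'y cdual" where
  "cdual_lact r b f = Cdual (\<lambda>y. cdual_apply f (r y b))"

definition cdual_ract ::
  "('b \<Rightarrow> 'y::complex_normed_vector \<Rightarrow> 'y) \<Rightarrow> 'y cdual \<Rightarrow> 'b \<Rightarrow> 'y cdual" where
  "cdual_ract l f b = Cdual (\<lambda>y. cdual_apply f (l b y))"

text \<open>The Banach space adjoint: linear in \<open>f\<close>, without conjugation.\<close>

definition cadjoint_map ::
  "('v::complex_normed_vector \<Rightarrow> 'w::complex_normed_vector) \<Rightarrow> 'w cdual \<Rightarrow> 'v cdual" where
  "cadjoint_map T f = Cdual (\<lambda>v. cdual_apply f (T v))"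

definition ccanon :: "'v::complex_normed_vector \<Rightarrow> 'v cdual cdual" where
  "ccanon v = Cdual (\<lambda>f. cdual_apply f v)"

definition cweak_star :: "'v::complex_normed_vector cdual topology" where
  "cweak_star = pullback_topology UNIV cdual_apply euclidean"

definition cweak_topology :: "'v::complex_normed_vector topology" where
  "cweak_topology = pullback_topology UNIV (\<lambda>v f. cdual_apply (f :: 'v cdual) v) euclidean"

definition carens_left ::
  "'a::complex_normed_algebra cdual cdual \<Rightarrow> 'a cdual \<Rightarrow> 'a cdual" where
  "carens_left G f = Cdual (\<lambda>a. cdual_apply G (cdual_ract (*) f a))"

definition carens_mult ::
  "'a::complex_normed_algebra cdual cdual \<Rightarrow> 'a cdual cdual \<Rightarrow> 'a cdual cdual" where
  "carens_mult F G = Cdual (\<lambda>f. cdual_apply F (carens_left G f))"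

definition cbidual_lact ::
  "('a::complex_normed_vector \<Rightarrow> 'x::complex_normed_vector \<Rightarrow> 'x) \<Rightarrow>
   'a cdual cdual \<Rightarrow> 'x cdual cdual \<Rightarrow> 'x cdual cdual" where
  "cbidual_lact l a'' x'' = (THE z. \<forall>F G. F \<noteq> bot \<longrightarrow> G \<noteq> bot \<longrightarrow>
      limitin cweak_star ccanon a'' F \<longrightarrow> limitin cweak_star ccanon x'' G \<longrightarrow>
      iterated_limit cweak_star (\<lambda>a x. ccanon (l a x)) z F G)"

definition cbidual_ract ::
  "('x::complex_normed_vector \<Rightarrow> 'a::complex_normed_vector \<Rightarrow> 'x) \<Rightarrow>
   'x cdual cdual \<Rightarrow> 'a cdual cdual \<Rightarrow> 'x cdual cdual" where
  "cbidual_ract r x'' a'' = (THE z. \<forall>F G. F \<noteq> bot \<longrightarrow> G \<noteq> bot \<longrightarrow>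
      limitin cweak_star ccanon a'' F \<longrightarrow> limitin cweak_star ccanon x'' G \<longrightarrow>
      iterated_limit cweak_star (\<lambda>x a. ccanon (r x a)) z G F)"

end

theory Submission
  imports Defs
begin

text \<open>
  Let \<open>h\<close> be a functional on \<open>X**\<close>. It has to be shown that \<open>a \<mapsto> h (x a)\<close> is weak* continuous on
  \<open>A**\<close>, that is, given by an element of \<open>A*\<close>. Since \<open>D\<close> is surjective, so is \<open>D''\<close>
  (\<open>surj_second_adjoint\<close>): \<open>D'\<close> is bounded below by the uniform boundedness principle, and the
  Hahn-Banach theorem extends functionals from its range. Write \<open>h = D'' b\<close>. As \<open>D''\<close> is a derivation,
  \<open>h (x a) = (a \<cdot> D'' b) x = D'' (a b) x - (D'' a \<cdot> b) x = a (b \<cdot> D' x) - a (D' (b x))\<close>,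
  where \<open>b \<cdot> D' x\<close> is the element of \<open>A*\<close> through which the first Arens product is defined. So
  \<open>b \<cdot> D' x - D' (b x)\<close> is the required element (\<open>right_ext_weakly_continuous\<close>).

  The module actions on \<open>X**\<close> are given by iterated limits. They are identified with the
  explicit extension of a bilinear map to the biduals in \<open>THE_iterated_limit\<close>, which
  makes their linearity and boundedness available. That the limits are not vacuous rests on the weak*
  density of a space in its bidual (\<open>dense_filter\<close>).

  The real and the complex case are instances of one argument over an abstract scalar field. Only the
  Hahn-Banach theorem and the completeness of the dual of \<open>X\<close> are proved separately.
\<close>

section \<open>The Hahn-Banach theorem\<close>

text \<open>
  Only the inequality for positive scalars is demanded, so that infima of families can be
  checked easily; homogeneity and \<open>p 0 = 0\<close> follow.
\<close>

definition sublinear :: "('w::real_vector \<Rightarrow> real) \<Rightarrow> bool" where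
  "sublinear p \<longleftrightarrow> (\<forall>x y. p (x + y) \<le> p x + p y) \<and> (\<forall>t>0. \<forall>x. p (t *\<^sub>R x) \<le> t * p x)"

lemma sublinear_add: "sublinear p \<Longrightarrow> p (x + y) \<le> p x + p y"
  by (simp add: sublinear_def)

lemma sublinear_zero:
  assumes "sublinear p" shows "p 0 = 0"
proof -
  have "p ((1/2) *\<^sub>R 0) \<le> (1/2) * p 0" "p (0 + 0) \<le> p 0 + p 0"
    using assms unfolding sublinear_def by (smt (verit) zero_less_divide_iff)+
  then show ?thesis by simp
qed

lemma sublinear_scale:
  assumes "sublinear p" "0 \<le> t" shows "p (t *\<^sub>R x) = t * p x"
proof (cases "t = 0")
  case False
  then have t: "0 < t" using assms by simp
  have "p (inverse t *\<^sub>R (t *\<^sub>R x)) \<le> inverse t * p (t *\<^sub>R x)"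
    using assms t unfolding sublinear_def by (meson inverse_positive_iff_positive)
  then have "t * p x \<le> p (t *\<^sub>R x)"
    using t by (simp add: field_simps)
  then show ?thesis using assms t unfolding sublinear_def by (meson order_antisym)
qed (use assms sublinear_zero in auto)

lemma sublinear_lower:
  assumes "sublinear p" shows "- p (- x) \<le> p x"
  using sublinear_add[OF assms, of x "- x"] sublinear_zero[OF assms] by simp

text \<open>
  All three infima formed in this section (over a chain, over the points of a ray, over the
  domain of an operator) are sublinear for this one reason: the family is closed, up to \<open>\<le>\<close>,
  under the operations that the two inequalities ask for.
\<close>

lemma sublinear_INF:
  fixes F :: "'i \<Rightarrow> 'w::real_vector \<Rightarrow> real"
  assumes "I \<noteq> {}"
    and bdd: "\<And>x. bdd_below ((\<lambda>i. F i x) ` I)"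
    and add: "\<And>i j x y. i \<in> I \<Longrightarrow> j \<in> I \<Longrightarrow> \<exists>k\<in>I. F k (x + y) \<le> F i x + F j y"
    and scale: "\<And>i t x. i \<in> I \<Longrightarrow> 0 < t \<Longrightarrow> \<exists>k\<in>I. F k (t *\<^sub>R x) \<le> t * F i x"
  shows "sublinear (\<lambda>x. INF i\<in>I. F i x)"
  unfolding sublinear_def
proof (intro conjI allI impI)
  fix x y
  have le: "(INF i\<in>I. F i (x + y)) \<le> F i x + F j y" if "i \<in> I" "j \<in> I" for i j
    using add[OF that, of x y] bdd by (meson cINF_lower2)
  have "(INF i\<in>I. F i (x + y)) - F i x \<le> (INF j\<in>I. F j y)" if "i \<in> I" for i
    using le[OF that] by (intro cINF_greatest assms(1)) (simp add: algebra_simps)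
  then have "(INF i\<in>I. F i (x + y)) - (INF j\<in>I. F j y) \<le> (INF i\<in>I. F i x)"
    by (intro cINF_greatest assms(1)) (simp add: algebra_simps)
  then show "(INF i\<in>I. F i (x + y)) \<le> (INF i\<in>I. F i x) + (INF i\<in>I. F i y)"
    by simp
next
  fix t :: real and x assume t: "0 < t"
  have "(INF i\<in>I. F i (t *\<^sub>R x)) \<le> t * F i x" if "i \<in> I" for i
    using scale[OF that t, of x] bdd by (meson cINF_lower2)
  then have "(INF i\<in>I. F i (t *\<^sub>R x)) / t \<le> (INF i\<in>I. F i x)"
    using t by (intro cINF_greatest assms(1)) (auto simp: field_simps)
  then show "(INF i\<in>I. F i (t *\<^sub>R x)) \<le> t * (INF i\<in>I. F i x)"
    using t by (simp add: field_simps)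
qed

text \<open>
  Lowers \<open>q\<close> in the direction \<open>y\<close>. If nothing below \<open>q\<close> is left, the last inequality becomes the
  reverse of subadditivity.
\<close>

lemma sublinear_ray_INF:
  fixes q :: "'w::real_vector \<Rightarrow> real" and y :: 'w
  assumes q: "sublinear q"
  defines "q' \<equiv> \<lambda>x. INF s\<in>{0..}. q (x + s *\<^sub>R y) - s * q y"
  shows "sublinear q'" and "q' x \<le> q x" and "q' x \<le> q (x + y) - q y"
proof -
  have low: "- q (- x) \<le> q (x + s *\<^sub>R y) - s * q y" if "0 \<le> s" for x s
    using sublinear_add[OF q, of "x + s *\<^sub>R y" "- x"] sublinear_scale[OF q that, of y] by simp
  then have bdd: "bdd_below ((\<lambda>s. q (x + s *\<^sub>R y) - s * q y) ` {0..})" for x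
    by (intro bdd_belowI2) auto
  show "sublinear q'"
    unfolding q'_def
  proof (rule sublinear_INF)
    fix s t :: real and x z :: 'w assume st: "s \<in> {0..}" "t \<in> {0..}"
    have "q (x + z + (s + t) *\<^sub>R y) \<le> q (x + s *\<^sub>R y) + q (z + t *\<^sub>R y)"
      using sublinear_add[OF q, of "x + s *\<^sub>R y" "z + t *\<^sub>R y"] by (simp add: algebra_simps)
    then have "q (x + z + (s + t) *\<^sub>R y) - (s + t) * q y
        \<le> q (x + s *\<^sub>R y) - s * q y + (q (z + t *\<^sub>R y) - t * q y)"
      by (simp add: algebra_simps)
    then show "\<exists>k\<in>{0..}. q (x + z + k *\<^sub>R y) - k * q y
        \<le> q (x + s *\<^sub>R y) - s * q y + (q (z + t *\<^sub>R y) - t * q y)"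
      using st by (intro bexI[of _ "s + t"]) auto
  next
    fix s t :: real and x :: 'w assume s: "s \<in> {0..}" and t: "0 < t"
    have "q (t *\<^sub>R x + (t * s) *\<^sub>R y) = t * q (x + s *\<^sub>R y)"
      using sublinear_scale[OF q, of t "x + s *\<^sub>R y"] t by (simp add: algebra_simps)
    then show "\<exists>k\<in>{0..}. q (t *\<^sub>R x + k *\<^sub>R y) - k * q y \<le> t * (q (x + s *\<^sub>R y) - s * q y)"
      using s t by (intro bexI[of _ "t * s"]) (auto simp: algebra_simps)
  qed (use bdd in auto)
  show "q' x \<le> q x" "q' x \<le> q (x + y) - q y"
    unfolding q'_def using cINF_lower[OF bdd, of 0 x] cINF_lower[OF bdd, of 1 x] by simp_all
qed

lemma minimal_sublinear_linear:
  assumes q: "sublinear q" and min: "\<And>q'. sublinear q' \<Longrightarrow> q' \<le> q \<Longrightarrow> q' = q"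
  shows "linear q"
proof -
  have add: "q (x + y) = q x + q y" for x y
  proof -
    have "(\<lambda>x. INF s\<in>{0..}. q (x + s *\<^sub>R y) - s * q y) = q"
      by (intro min le_funI sublinear_ray_INF[OF q])
    from fun_cong[OF this, of x] have "q x \<le> q (x + y) - q y"
      using sublinear_ray_INF(3)[OF q, where x=x and y=y] by simp
    then show ?thesis using sublinear_add[OF q, of x y] by simp
  qed
  have neg: "q (- x) = - q x" for x
    using add[of x "- x"] sublinear_zero[OF q] by simp
  have "q (t *\<^sub>R x) = t * q x" for t x
    using sublinear_scale[OF q, of t x] sublinear_scale[OF q, of "- t" x] neg[of "t *\<^sub>R x"]
    by (cases "0 \<le> t") auto
  with add show ?thesis by (intro linearI) auto
qed

text \<open>
  Zorn's lemma, applied downwards, gives a minimal sublinear function. Working with functions on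
  the whole space avoids partially defined functionals.
\<close>

lemma linear_below_sublinear:
  fixes p :: "'w::real_vector \<Rightarrow> real"
  assumes p: "sublinear p"
  obtains g where "linear g" "g \<le> p"
proof -
  let ?A = "{q. sublinear q \<and> q \<le> p}"
  \<comment> \<open>A bound that is the same for all candidates, so that infima of chains exist.\<close>
  have low: "- p (- x) \<le> q x" if "q \<in> ?A" for q x
  proof -
    have "- p (- x) \<le> - q (- x)" using that by (simp add: le_fun_def)
    also have "\<dots> \<le> q x" using that by (simp add: sublinear_lower)
    finally show ?thesis .
  qed
  have "\<exists>m\<in>?A. \<forall>q\<in>?A. q \<le> m \<longrightarrow> q = m"
  proof (rule predicate_Zorn)
    show "partial_order_on ?A (relation_of (\<lambda>q q'. q' \<le> q) ?A)"
      by (rule partial_order_on_relation_ofI) auto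
    fix C assume "C \<in> Chains (relation_of (\<lambda>q q'. q' \<le> q) ?A)"
    then have CA: "C \<subseteq> ?A" and tot: "\<And>q q'. q \<in> C \<Longrightarrow> q' \<in> C \<Longrightarrow> q \<le> q' \<or> q' \<le> q"
      unfolding Chains_def relation_of_def by auto
    show "\<exists>u\<in>?A. \<forall>q\<in>C. u \<le> q"
    proof (cases "C = {}")
      case True
      then show ?thesis using p by auto
    next
      case False
      have bdd: "bdd_below ((\<lambda>q. q x) ` C)" for x
        using low CA by (intro bdd_belowI2[where m="- p (- x)"]) auto
      have "sublinear (\<lambda>x. INF q\<in>C. q x)"
      proof (rule sublinear_INF[OF False bdd])
        fix q q' x y assume qq: "q \<in> C" "q' \<in> C"
        show "\<exists>k\<in>C. k (x + y) \<le> q x + q' y"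
          using tot[OF qq]
        proof
          assume "q \<le> q'"
          then show ?thesis
            using sublinear_add[of q x y] le_funD[OF \<open>q \<le> q'\<close>, of y] CA qq
            by (intro bexI[of _ q]) auto
        next
          assume "q' \<le> q"
          then show ?thesis
            using sublinear_add[of q' x y] le_funD[OF \<open>q' \<le> q\<close>, of x] CA qq
            by (intro bexI[of _ q']) auto
        qed
      next
        fix q t x assume "q \<in> C" "(0::real) < t"
        then show "\<exists>k\<in>C. k (t *\<^sub>R x) \<le> t * q x"
          using CA unfolding sublinear_def by auto
      qed
      moreover have "(\<lambda>x. INF q\<in>C. q x) \<le> q" if "q \<in> C" for q
        using cINF_lower[OF bdd that] by (auto simp: le_fun_def)
      moreover obtain q where "q \<in> C" "q \<le> p"
        using False CA by blast
      ultimately show ?thesis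
        by (intro bexI[of _ "\<lambda>x. INF q\<in>C. q x"]) (auto intro: order_trans)
    qed
  qed
  then obtain m where m: "m \<in> ?A" "\<And>q. q \<in> ?A \<Longrightarrow> q \<le> m \<Longrightarrow> q = m"
    by blast
  have "linear m"
    using m by (intro minimal_sublinear_linear) (auto intro: order_trans)
  with m that show ?thesis by blast
qed

text \<open>
  The Hahn-Banach theorem for the functional \<open>T v \<mapsto> \<phi> v\<close> on the range of \<open>T\<close>, which is well
  defined and bounded by the hypothesis. The function \<open>?p\<close> in the proof is the largest sublinear
  function that is at most \<open>C * norm w\<close> everywhere and at most \<open>\<phi> v\<close> at \<open>T v\<close>; a linear function
  below it equals \<open>\<phi> v\<close> at \<open>T v\<close>, as one sees by replacing \<open>v\<close> by \<open>- v\<close>.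
\<close>

theorem hahn_banach_factor:
  fixes T :: "'v::real_vector \<Rightarrow> 'w::real_normed_vector" and \<phi> :: "'v \<Rightarrow> real"
  assumes T: "linear T" and \<phi>: "linear \<phi>" and bound: "\<And>v. \<bar>\<phi> v\<bar> \<le> C * norm (T v)" and "0 \<le> C"
  obtains g where "bounded_linear g" "\<And>v. g (T v) = \<phi> v"
proof -
  let ?p = "\<lambda>w. INF v. C * norm (w - T v) + \<phi> v"
  interpret T: linear T by fact
  interpret \<phi>: linear \<phi> by fact
  have low: "- C * norm w \<le> C * norm (w - T v) + \<phi> v" for w v
  proof -
    have "C * norm (T v) \<le> C * (norm w + norm (w - T v))"
      using norm_triangle_ineq4[of w "w - T v"] \<open>0 \<le> C\<close> by (intro mult_left_mono) auto
    then show ?thesis using bound[of v] by (simp add: algebra_simps)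
  qed
  then have bdd: "bdd_below (range (\<lambda>v. C * norm (w - T v) + \<phi> v))" for w
    by (intro bdd_belowI2)
  have "sublinear ?p"
  proof (rule sublinear_INF)
    fix u v and x y :: 'w
    have "C * norm (x + y - T (u + v)) \<le> C * (norm (x - T u) + norm (y - T v))"
      using norm_triangle_ineq[of "x - T u" "y - T v"] \<open>0 \<le> C\<close>
      by (intro mult_left_mono) (auto simp: T.add algebra_simps)
    then show "\<exists>k\<in>UNIV. C * norm (x + y - T k) + \<phi> k
        \<le> C * norm (x - T u) + \<phi> u + (C * norm (y - T v) + \<phi> v)"
      by (intro bexI[of _ "u + v"]) (auto simp: \<phi>.add algebra_simps)
  next
    fix v and t :: real and x :: 'w assume "0 < t"
    then have "norm (t *\<^sub>R x - T (t *\<^sub>R v)) = t * norm (x - T v)"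
      by (simp add: T.scale flip: scaleR_diff_right)
    then show "\<exists>k\<in>UNIV. C * norm (t *\<^sub>R x - T k) + \<phi> k \<le> t * (C * norm (x - T v) + \<phi> v)"
      by (intro bexI[of _ "t *\<^sub>R v"]) (auto simp: \<phi>.scale algebra_simps)
  qed (use bdd in auto)
  then obtain g where g: "linear g" "g \<le> ?p"
    by (rule linear_below_sublinear)
  interpret g: linear g by fact
  have le: "g w \<le> C * norm (w - T v) + \<phi> v" for w v
    using le_funD[OF g(2), of w] cINF_lower[OF bdd, of v w] by simp
  have "\<bar>g w\<bar> \<le> C * norm w" for w
    using le[of w 0] le[of "- w" 0] by (simp add: T.zero \<phi>.zero g.neg abs_le_iff)
  then have "bounded_linear g"
    using g(1) by (intro bounded_linear.intro bounded_linear_axioms.intro exI[of _ C]) (auto simp: mult.commute)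
  moreover have "g (T v) = \<phi> v" for v
    using le[of "T v" v] le[of "T (- v)" "- v"] by (simp add: T.neg \<phi>.neg g.neg)
  ultimately show ?thesis using that by blast
qed

section \<open>The uniform boundedness principle\<close>

text \<open>
  Baire's theorem yields a ball on which the family is bounded by some \<open>n\<close>, and differences of
  points of that ball fill a ball around \<open>0\<close>. Completeness is a hypothesis on the space and not
  a type class constraint because the theorem will be applied to the type \<open>'v cdual\<close>.
\<close>

theorem uniform_boundedness:
  fixes \<F> :: "('v::real_normed_vector \<Rightarrow> 'w::real_normed_vector) set"
  assumes complete: "complete (UNIV :: 'v set)" and lin: "\<And>T. T \<in> \<F> \<Longrightarrow> bounded_linear T"
    and pointwise: "\<And>v. \<exists>K. \<forall>T\<in>\<F>. norm (T v) \<le> K"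
  obtains C where "0 \<le> C" "\<And>T v. T \<in> \<F> \<Longrightarrow> norm (T v) \<le> C * norm v"
proof -
  let ?S = "\<lambda>n::nat. {v. \<forall>T\<in>\<F>. norm (T v) \<le> real n}"
  have closed: "closed (?S n)" for n
  proof -
    have "?S n = (\<Inter>T\<in>\<F>. {v. norm (T v) \<le> real n})" by auto
    moreover have "closed {v. norm (T v) \<le> real n}" if "T \<in> \<F>" for T
      by (intro closed_Collect_le continuous_intros linear_continuous_on lin that)
    ultimately show ?thesis by auto
  qed
  have "(\<Union>n. ?S n) = UNIV"
    using pointwise by auto (meson order_trans real_arch_simple)
  have "\<exists>n. interior (?S n) \<noteq> {}"
  proof (rule ccontr)
    assume neg: "\<nexists>n. interior (?S n) \<noteq> {}"
    have "completely_metrizable_space (euclidean :: 'v topology)"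
      unfolding completely_metrizable_space_def
      using complete Met_TC.Metric_space_axioms mcomplete_iff_complete mtopology_is_euclidean by metis
    then have "euclidean interior_of \<Union>(range ?S) = {}"
      using neg closed by (intro Baire_category_alt) (auto simp: )
    then show False
      using \<open>(\<Union>n. ?S n) = UNIV\<close> by simp
  qed
  then obtain n x e where "0 < e" and ball: "cball x e \<subseteq> ?S n"
    by (metis (lifting) all_not_in_conv mem_interior_cball)
  have "norm (T v) \<le> (2 * real n / e) * norm v" if T: "T \<in> \<F>" for T v
  proof (cases "v = 0")
    case True
    then show ?thesis using linear_0[OF bounded_linear.linear[OF lin[OF T]]] by simp
  next
    case False
    interpret T: bounded_linear T using lin T .
    let ?y = "(e / norm v) *\<^sub>R v"
    have "x \<in> cball x e" "x + ?y \<in> cball x e"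
      using \<open>0 < e\<close> False by (auto simp: dist_norm)
    then have "x \<in> ?S n" "x + ?y \<in> ?S n"
      using ball by blast+
    then have "norm (T x) \<le> real n" "norm (T x + T ?y) \<le> real n"
      using T by (auto simp: T.add)
    then have "norm (T ?y) \<le> 2 * real n"
      using norm_triangle_ineq4[of "T x + T ?y" "T x"] by simp
    then show ?thesis
      using \<open>0 < e\<close> False by (simp add: T.scaleR field_simps)
  qed
  then show ?thesis
    using \<open>0 < e\<close> by (intro that[of "2 * real n / e"]) auto
qed

section \<open>Dual spaces over an abstract scalar field\<close>

text \<open>
  The field \<open>'k\<close> enters a space \<open>'v\<close> through an explicit scalar multiplication
  \<open>s :: 'k \<Rightarrow> 'v \<Rightarrow> 'v\<close>. It will be \<open>scaleR\<close> or \<open>scaleC\<close>, and the argument is carried out once for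
  both.
\<close>

definition klinear ::
  "('k \<Rightarrow> 'v::real_normed_vector \<Rightarrow> 'v) \<Rightarrow> ('k \<Rightarrow> 'w::real_normed_vector \<Rightarrow> 'w) \<Rightarrow> ('v \<Rightarrow> 'w) \<Rightarrow> bool" where
  "klinear s t T \<longleftrightarrow> bounded_linear T \<and> (\<forall>c v. T (s c v) = t c (T v))"

definition kbilinear ::
  "('k \<Rightarrow> 'u::real_normed_vector \<Rightarrow> 'u) \<Rightarrow> ('k \<Rightarrow> 'v::real_normed_vector \<Rightarrow> 'v) \<Rightarrow>
   ('k \<Rightarrow> 'w::real_normed_vector \<Rightarrow> 'w) \<Rightarrow> ('u \<Rightarrow> 'v \<Rightarrow> 'w) \<Rightarrow> bool" where
  "kbilinear s t w B \<longleftrightarrow> bounded_bilinear B \<and>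
     (\<forall>c u v. B (s c u) v = w c (B u v)) \<and> (\<forall>c u v. B u (t c v) = w c (B u v))"

lemma klinear_compose: "klinear s t T \<Longrightarrow> klinear t w S \<Longrightarrow> klinear s w (\<lambda>v. S (T v))"
  by (auto simp: klinear_def intro: bounded_linear_compose)

lemma kbilinear_left: "kbilinear s t w B \<Longrightarrow> klinear s w (\<lambda>u. B u v)"
  by (auto simp: kbilinear_def klinear_def intro: bounded_bilinear.bounded_linear_left)

lemma kbilinear_right: "kbilinear s t w B \<Longrightarrow> klinear t w (B u)"
  by (auto simp: kbilinear_def klinear_def intro: bounded_bilinear.bounded_linear_right)

text \<open>
  The space \<open>'d\<close> is the dual of \<open>'v\<close>: \<open>ap\<close> evaluates a functional, and \<open>mk\<close> turns a bounded
  linear function into a functional, with an arbitrary value on other functions. The instances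
  are \<open>blinfun_apply\<close>, \<open>Blinfun\<close> and \<open>cdual_apply\<close>, \<open>Cdual\<close>.
\<close>

locale dual_space =
  fixes s :: "'k::real_normed_field \<Rightarrow> 'v::real_normed_vector \<Rightarrow> 'v"
    and s1 :: "'k \<Rightarrow> 'd::real_normed_vector \<Rightarrow> 'd"
    and ap :: "'d \<Rightarrow> 'v \<Rightarrow> 'k" and mk :: "('v \<Rightarrow> 'k) \<Rightarrow> 'd"
  assumes ap_bilinear: "kbilinear s1 s (*) ap"
    and ap_mk: "klinear s (*) \<phi> \<Longrightarrow> ap (mk \<phi>) = \<phi>"
    and ap_eqI: "(\<And>v. ap f v = ap g v) \<Longrightarrow> f = g"
    and dual_norm_le: "0 \<le> C \<Longrightarrow> (\<And>v. norm (ap f v) \<le> C * norm v) \<Longrightarrow> norm f \<le> C"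
begin

sublocale ap: bounded_bilinear ap
  using ap_bilinear by (simp add: kbilinear_def)

lemma ap_scale_left: "ap (s1 c f) v = c * ap f v"
  and ap_scale_right: "ap f (s c v) = c * ap f v"
  using ap_bilinear by (simp_all add: kbilinear_def)

lemma ap_linear_left: "klinear s1 (*) (\<lambda>f. ap f v)"
  and ap_linear_right: "klinear s (*) (ap f)"
  using ap_bilinear by (rule kbilinear_left kbilinear_right)+

end

text \<open>
  The adjoint in the sense of Arens: \<open>B : P \<times> Q \<rightarrow> R\<close> gives \<open>R* \<times> P \<rightarrow> Q*\<close>. Three applications
  extend \<open>B\<close> to the biduals, \<open>P** \<times> Q** \<rightarrow> R**\<close>.
\<close>

definition bilinear_adjoint ::
  "(('q \<Rightarrow> 'k) \<Rightarrow> 'q1) \<Rightarrow> ('r1 \<Rightarrow> 'r \<Rightarrow> 'k) \<Rightarrow> ('p \<Rightarrow> 'q \<Rightarrow> 'r) \<Rightarrow> 'r1 \<Rightarrow> 'p \<Rightarrow> 'q1" where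
  "bilinear_adjoint mk ap B = (\<lambda>f p. mk (\<lambda>q. ap f (B p q)))"

lemma ap_bilinear_adjoint:
  assumes "dual_space sq sq1 apq mkq" "dual_space sr sr1 apr mkr" "kbilinear sp sq sr B"
  shows "apq (bilinear_adjoint mkq apr B f p) q = apr f (B p q)"
  unfolding bilinear_adjoint_def
  by (subst dual_space.ap_mk[OF assms(1)])
    (auto intro: klinear_compose kbilinear_right assms dual_space.ap_linear_right)

lemma kbilinear_bilinear_adjoint:
  assumes q: "dual_space sq sq1 apq mkq" and r: "dual_space sr sr1 apr mkr" and B: "kbilinear sp sq sr B"
  shows "kbilinear sr1 sp sq1 (bilinear_adjoint mkq apr B)"
proof -
  interpret q: dual_space sq sq1 apq mkq by fact
  interpret r: dual_space sr sr1 apr mkr by fact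
  interpret B: bounded_bilinear B using B by (simp add: kbilinear_def)
  have B_scale: "B (sp c p) x = sr c (B p x)" for c p x
    using B by (simp add: kbilinear_def)
  note ap = ap_bilinear_adjoint[OF q r B]
  obtain K where K: "0 \<le> K" "\<And>p x. norm (B p x) \<le> norm p * norm x * K"
    using B.nonneg_bounded by blast
  obtain L where L: "0 \<le> L" "\<And>f y. norm (apr f y) \<le> norm f * norm y * L"
    using r.ap.nonneg_bounded by blast
  have "norm (bilinear_adjoint mkq apr B f p) \<le> norm f * norm p * (K * L)" for f p
  proof (rule q.dual_norm_le)
    fix x
    have "norm (apr f (B p x)) \<le> norm f * (norm p * norm x * K) * L"
      using L(2)[of f "B p x"] K L(1)
      by (meson mult_left_mono mult_right_mono norm_ge_zero order_trans)
    then show "norm (apq (bilinear_adjoint mkq apr B f p) x) \<le> norm f * norm p * (K * L) * norm x"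
      by (simp add: ap mult_ac)
  qed (use K L in auto)
  then show ?thesis
    unfolding kbilinear_def
    by (intro conjI bounded_bilinear.intro allI exI[of _ "K * L"] q.ap_eqI)
      (simp_all add: ap q.ap.add_left q.ap.scaleR_left q.ap_scale_left r.ap.add_left r.ap.scaleR_left
        r.ap_scale_left r.ap.add_right r.ap.scaleR_right r.ap_scale_right B.add_left B.scaleR_left B_scale)
qed

definition dual_adjoint ::
  "(('v \<Rightarrow> 'k) \<Rightarrow> 'v1) \<Rightarrow> ('w1 \<Rightarrow> 'w \<Rightarrow> 'k) \<Rightarrow> ('v \<Rightarrow> 'w) \<Rightarrow> 'w1 \<Rightarrow> 'v1" where
  "dual_adjoint mk ap T = (\<lambda>f. mk (\<lambda>v. ap f (T v)))"

lemma ap_adjoint: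
  assumes v: "dual_space sv sv1 apv mkv" and w: "dual_space sw sw1 apw mkw" and T: "klinear sv sw T"
  shows "apv (dual_adjoint mkv apw T f) v = apw f (T v)"
  unfolding dual_adjoint_def
  by (subst dual_space.ap_mk[OF v]) (auto intro: klinear_compose[OF T] dual_space.ap_linear_right[OF w])

lemma klinear_adjoint:
  assumes v: "dual_space sv sv1 apv mkv" and w: "dual_space sw sw1 apw mkw" and T: "klinear sv sw T"
  shows "klinear sw1 sv1 (dual_adjoint mkv apw T)"
proof -
  interpret v: dual_space sv sv1 apv mkv by fact
  interpret w: dual_space sw sw1 apw mkw by fact
  interpret T: bounded_linear T using T by (simp add: klinear_def)
  note ap = ap_adjoint[OF assms]
  obtain K where K: "0 \<le> K" "\<And>x. norm (T x) \<le> norm x * K"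
    using T.nonneg_bounded by blast
  obtain L where L: "0 \<le> L" "\<And>f y. norm (apw f y) \<le> norm f * norm y * L"
    using w.ap.nonneg_bounded by blast
  have "norm (dual_adjoint mkv apw T f) \<le> norm f * (K * L)" for f
  proof (rule v.dual_norm_le)
    fix x
    have "norm (apw f (T x)) \<le> norm f * (norm x * K) * L"
      using L(2)[of f "T x"] K L(1)
      by (meson mult_left_mono mult_right_mono norm_ge_zero order_trans)
    then show "norm (apv (dual_adjoint mkv apw T f) x) \<le> norm f * (K * L) * norm x"
      by (simp add: ap mult_ac)
  qed (use K L in auto)
  then show ?thesis
    unfolding klinear_def
    by (intro conjI bounded_linear_intro[of _ "K * L"] allI v.ap_eqI)
      (simp_all add: ap v.ap.add_left v.ap.scaleR_left v.ap_scale_left w.ap.add_left w.ap.scaleR_left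
        w.ap_scale_left)
qed

section \<open>Biduals and weak* density\<close>

locale bidual_space = d1: dual_space s s1 ap1 mk1 + d2: dual_space s1 s2 ap2 mk2
  for s :: "'k::real_normed_field \<Rightarrow> 'v::real_normed_vector \<Rightarrow> 'v"
    and s1 :: "'k \<Rightarrow> 'd::real_normed_vector \<Rightarrow> 'd"
    and s2 :: "'k \<Rightarrow> 'e::real_normed_vector \<Rightarrow> 'e"
    and ap1 mk1 ap2 mk2
begin

definition embed :: "'v \<Rightarrow> 'e" where
  "embed v = mk2 (\<lambda>f. ap1 f v)"

lemma ap_embed [simp]: "ap2 (embed v) f = ap1 f v"
  unfolding embed_def by (subst d2.ap_mk) (auto intro: d1.ap_linear_left)

text \<open>
  If the kernel of \<open>g\<close> contains the common kernel of the finitely many functionals in \<open>S\<close>, then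
  \<open>g\<close> is a linear combination of them; this is the consequence of that fact for an element \<open>z\<close>
  of the bidual. In the induction, \<open>g\<close> is corrected by a multiple of the new functional \<open>k\<close>.
\<close>

lemma bidual_vanishes:
  assumes "finite S" "\<And>f. f \<in> S \<Longrightarrow> ap2 z f = 0"
    and "\<And>v. (\<And>f. f \<in> S \<Longrightarrow> ap1 f v = 0) \<Longrightarrow> ap1 g v = 0"
  shows "ap2 z g = 0"
  using assms
proof (induction S arbitrary: g rule: finite_induct)
  case empty
  then have "g = 0" by (intro d1.ap_eqI) (simp add: d1.ap.zero_left)
  then show ?case by (simp add: d2.ap.zero_right)
next
  case (insert k S)
  show ?case
  proof (cases "\<forall>v. (\<forall>f\<in>S. ap1 f v = 0) \<longrightarrow> ap1 k v = 0")
    case True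
    show ?thesis
    proof (rule insert.IH)
      fix v assume "\<And>f. f \<in> S \<Longrightarrow> ap1 f v = 0"
      with True show "ap1 g v = 0" by (intro insert.prems(2)) auto
    qed (use insert.prems(1) in auto)
  next
    case False
    then obtain v where v: "\<And>f. f \<in> S \<Longrightarrow> ap1 f v = 0" "ap1 k v \<noteq> 0" by blast
    define c where "c = ap1 g v / ap1 k v"
    have "ap2 z (g - s1 c k) = 0"
    proof (rule insert.IH)
      fix w assume w: "\<And>f. f \<in> S \<Longrightarrow> ap1 f w = 0"
      have "ap1 g (w - s (ap1 k w / ap1 k v) v) = 0"
        by (rule insert.prems(2)) (use v w in \<open>auto simp: d1.ap.diff_right d1.ap_scale_right\<close>)
      then show "ap1 (g - s1 c k) w = 0"
        by (simp add: c_def d1.ap.diff_right d1.ap.diff_left d1.ap_scale_left d1.ap_scale_right)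
    qed (use insert in auto)
    then show ?thesis
      using insert.prems(1)[of k] by (simp add: d2.ap.diff_right d2.ap_scale_right)
  qed
qed

text \<open>
  Weak* density of the canonical image in its algebraic form: Goldstine's theorem without the
  bound on the norm of \<open>v\<close>, so that linear algebra suffices.
\<close>

lemma interpolation:
  assumes "finite S"
  shows "\<exists>v. \<forall>f\<in>S. ap1 f v = ap2 z f"
  using assms
proof (induction rule: finite_induct)
  case (insert k S)
  then obtain v where v: "\<And>f. f \<in> S \<Longrightarrow> ap1 f v = ap2 z f" by blast
  show ?case
  proof (cases "\<forall>w. (\<forall>f\<in>S. ap1 f w = 0) \<longrightarrow> ap1 k w = 0")
    case True
    have "ap2 (z - embed v) k = 0"
      by (rule bidual_vanishes[OF insert.hyps(1)]) (use True v in \<open>auto simp: d2.ap.diff_left\<close>)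
    then show ?thesis
      using v by (intro exI[of _ v]) (auto simp: d2.ap.diff_left)
  next
    case False
    then obtain w where w: "\<And>f. f \<in> S \<Longrightarrow> ap1 f w = 0" "ap1 k w \<noteq> 0" by blast
    then show ?thesis
      using v by (intro exI[of _ "v + s ((ap2 z k - ap1 k v) / ap1 k w) w"])
        (auto simp: d1.ap.add_right d1.ap_scale_right)
  qed
qed auto

abbreviation weak_star_top :: "'e topology" where
  "weak_star_top \<equiv> pullback_topology UNIV ap2 euclidean"

end

lemma tendsto_fun_iff:
  fixes f :: "'i \<Rightarrow> 'a \<Rightarrow> 'b::topological_space"
  shows "(f \<longlongrightarrow> l) F \<longleftrightarrow> (\<forall>x. ((\<lambda>i. f i x) \<longlongrightarrow> l x) F)"
  using limitin_componentwise[of "\<lambda>_. euclidean" UNIV f l F]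
  by (simp add: euclidean_product_topology)

lemma limitin_pullback_euclidean:
  fixes ap :: "'z \<Rightarrow> 'a \<Rightarrow> 'b::topological_space"
  shows "limitin (pullback_topology UNIV ap euclidean) f l F \<longleftrightarrow>
    (\<forall>x. ((\<lambda>i. ap (f i) x) \<longlongrightarrow> ap l x) F)"
proof -
  have "limitin (pullback_topology UNIV ap euclidean) f l F \<longleftrightarrow> ((\<lambda>i. ap (f i)) \<longlongrightarrow> ap l) F"
    unfolding limitin_def tendsto_def topspace_pullback_topology openin_pullback_topology by auto
  then show ?thesis by (simp add: tendsto_fun_iff)
qed

lemma continuous_map_pullback_euclidean:
  fixes ap :: "'z \<Rightarrow> 'a \<Rightarrow> 'b::topological_space" and aq :: "'y \<Rightarrow> 'c \<Rightarrow> 'b"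
  assumes "\<And>g. \<exists>x. \<forall>z. aq (h z) g = ap z x"
  shows "continuous_map (pullback_topology UNIV ap euclidean) (pullback_topology UNIV aq euclidean) h"
proof (rule continuous_map_pullback')
  have "continuous_map (pullback_topology UNIV ap euclidean) euclidean (\<lambda>z. aq (h z) g)" for g
  proof -
    obtain x where x: "\<And>z. aq (h z) g = ap z x" using assms by blast
    have "continuous_map (pullback_topology UNIV ap euclidean) euclidean ((\<lambda>\<phi>. \<phi> x) \<circ> ap)"
      by (intro continuous_map_pullback) (simp add: continuous_map_iff_continuous2)
    then show ?thesis by (simp add: x o_def)
  qed
  then show "continuous_map (pullback_topology UNIV ap euclidean) euclidean (aq \<circ> h)"
    using continuous_map_componentwise_UNIV[of _ "\<lambda>_. euclidean" "aq \<circ> h"]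
    by (simp add: euclidean_product_topology)
qed auto

text \<open>
  A net indexed by the finite sets of functionals: its member at \<open>S\<close> agrees with \<open>z\<close> on \<open>S\<close>, so
  that on each functional the net is eventually constant.
\<close>

lemma (in bidual_space) dense_filter:
  obtains F where "F \<noteq> bot" "limitin weak_star_top embed z F"
proof -
  obtain v where v: "\<And>S f. finite S \<Longrightarrow> f \<in> S \<Longrightarrow> ap1 f (v S) = ap2 z f"
    using interpolation[of _ z] by metis
  let ?F = "filtermap v (finite_subsets_at_top UNIV)"
  have "((\<lambda>x. ap1 f x) \<longlongrightarrow> ap2 z f) ?F" for f
    unfolding filterlim_filtermap
    by (rule tendsto_eventually) (auto simp: eventually_finite_subsets_at_top v intro!: exI[of _ "{f}"])
  then have "limitin weak_star_top embed z ?F"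
    by (simp add: limitin_pullback_euclidean)
  moreover have "?F \<noteq> bot"
    by (simp add: filtermap_bot_iff)
  ultimately show ?thesis using that by blast
qed


section \<open>The Arens extension of a bilinear map\<close>

locale bidual_bilinear =
  u: bidual_space su su1 su2 apu1 mku1 apu2 mku2 +
  v: bidual_space sv sv1 sv2 apv1 mkv1 apv2 mkv2 +
  w: bidual_space sw sw1 sw2 apw1 mkw1 apw2 mkw2
  for su :: "'k::real_normed_field \<Rightarrow> 'u::real_normed_vector \<Rightarrow> 'u"
    and su1 :: "'k \<Rightarrow> 'u1::real_normed_vector \<Rightarrow> 'u1"
    and su2 :: "'k \<Rightarrow> 'u2::real_normed_vector \<Rightarrow> 'u2"
    and apu1 mku1 apu2 mku2
    and sv :: "'k \<Rightarrow> 'v::real_normed_vector \<Rightarrow> 'v"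
    and sv1 :: "'k \<Rightarrow> 'v1::real_normed_vector \<Rightarrow> 'v1"
    and sv2 :: "'k \<Rightarrow> 'v2::real_normed_vector \<Rightarrow> 'v2"
    and apv1 mkv1 apv2 mkv2
    and sw :: "'k \<Rightarrow> 'w::real_normed_vector \<Rightarrow> 'w"
    and sw1 :: "'k \<Rightarrow> 'w1::real_normed_vector \<Rightarrow> 'w1"
    and sw2 :: "'k \<Rightarrow> 'w2::real_normed_vector \<Rightarrow> 'w2"
    and apw1 mkw1 apw2 mkw2 +
  fixes m :: "'u \<Rightarrow> 'v \<Rightarrow> 'w"
  assumes m: "kbilinear su sv sw m"
begin

definition adj1 :: "'w1 \<Rightarrow> 'u \<Rightarrow> 'v1" where
  "adj1 = bilinear_adjoint mkv1 apw1 m"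

definition adj2 :: "'v2 \<Rightarrow> 'w1 \<Rightarrow> 'u1" where
  "adj2 = bilinear_adjoint mku1 apv2 adj1"

definition ext :: "'u2 \<Rightarrow> 'v2 \<Rightarrow> 'w2" where
  "ext = bilinear_adjoint mkw2 apu2 adj2"

lemma adj1_bilinear: "kbilinear sw1 su sv1 adj1"
  unfolding adj1_def
  by (rule kbilinear_bilinear_adjoint[OF v.d1.dual_space_axioms w.d1.dual_space_axioms m])

lemma adj2_bilinear: "kbilinear sv2 sw1 su1 adj2"
  unfolding adj2_def
  by (rule kbilinear_bilinear_adjoint[OF u.d1.dual_space_axioms v.d2.dual_space_axioms adj1_bilinear])

lemma ext_bilinear: "kbilinear su2 sv2 sw2 ext"
  unfolding ext_def
  by (rule kbilinear_bilinear_adjoint[OF w.d2.dual_space_axioms u.d2.dual_space_axioms adj2_bilinear])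

lemma ap_adj1: "apv1 (adj1 f a) b = apw1 f (m a b)"
  unfolding adj1_def
  by (rule ap_bilinear_adjoint[OF v.d1.dual_space_axioms w.d1.dual_space_axioms m])

lemma ap_adj2: "apu1 (adj2 y f) a = apv2 y (adj1 f a)"
  unfolding adj2_def
  by (rule ap_bilinear_adjoint[OF u.d1.dual_space_axioms v.d2.dual_space_axioms adj1_bilinear])

lemma ap_ext: "apw2 (ext x y) f = apu2 x (adj2 y f)"
  unfolding ext_def
  by (rule ap_bilinear_adjoint[OF w.d2.dual_space_axioms u.d2.dual_space_axioms adj2_bilinear])

text \<open>
  For a fixed first argument \<open>a\<close> the inner limit is \<open>ext (embed a) y\<close>, and \<open>ext\<close> is weak*
  continuous in its first argument. Both limits are taken at one functional at a time, so they
  exist along every pair of filters with the given weak* limits, bounded or not.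
\<close>

lemma iterated_limit_iff_ext:
  assumes F: "F \<noteq> bot" "limitin u.weak_star_top u.embed x F"
    and G: "G \<noteq> bot" "limitin v.weak_star_top v.embed y G"
  shows "iterated_limit w.weak_star_top (\<lambda>a b. w.embed (m a b)) z F G \<longleftrightarrow> z = ext x y"
proof -
  have inner: "limitin w.weak_star_top (\<lambda>b. w.embed (m a b)) (ext (u.embed a) y) G" for a
    using G(2) by (simp add: limitin_pullback_euclidean ap_ext ap_adj2 flip: ap_adj1)
  have outer: "limitin w.weak_star_top (\<lambda>a. ext (u.embed a) y) (ext x y) F"
    using F(2) by (simp add: limitin_pullback_euclidean ap_ext)
  have unique: "z = z'"
    if "H \<noteq> bot" "limitin w.weak_star_top h z H" "limitin w.weak_star_top h z' H" for h z z' and H :: "'i filter"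
    using that by (intro w.d2.ap_eqI) (auto simp: limitin_pullback_euclidean intro: tendsto_unique)
  show ?thesis
  proof
    assume "iterated_limit w.weak_star_top (\<lambda>a b. w.embed (m a b)) z F G"
    then obtain t where t: "\<forall>\<^sub>F a in F. limitin w.weak_star_top (\<lambda>b. w.embed (m a b)) (t a) G"
      and z: "limitin w.weak_star_top t z F"
      unfolding iterated_limit_def by blast
    from t have "\<forall>\<^sub>F a in F. ext (u.embed a) y = t a"
      by eventually_elim (rule unique[OF G(1) inner])
    then have "limitin w.weak_star_top t (ext x y) F"
      using outer by (rule limitin_transform_eventually)
    then show "z = ext x y" by (rule unique[OF F(1) z])
  next
    assume "z = ext x y"
    then show "iterated_limit w.weak_star_top (\<lambda>a b. w.embed (m a b)) z F G"
      unfolding iterated_limit_def using inner outer by (intro exI[of _ "\<lambda>a. ext (u.embed a) y"]) simp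
  qed
qed

text \<open>
  The two forms differ in the order in which the filters are quantified; the second one is that
  of the right module action.
\<close>

lemma THE_iterated_limit:
  shows "(THE z. \<forall>F G. F \<noteq> bot \<longrightarrow> G \<noteq> bot \<longrightarrow>
      limitin u.weak_star_top u.embed x F \<longrightarrow> limitin v.weak_star_top v.embed y G \<longrightarrow>
      iterated_limit w.weak_star_top (\<lambda>a b. w.embed (m a b)) z F G) = ext x y"
    and "(THE z. \<forall>G F. G \<noteq> bot \<longrightarrow> F \<noteq> bot \<longrightarrow>
      limitin v.weak_star_top v.embed y G \<longrightarrow> limitin u.weak_star_top u.embed x F \<longrightarrow>
      iterated_limit w.weak_star_top (\<lambda>a b. w.embed (m a b)) z F G) = ext x y"
proof -
  obtain F where F: "F \<noteq> bot" "limitin u.weak_star_top u.embed x F"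
    by (rule u.dense_filter)
  obtain G where G: "G \<noteq> bot" "limitin v.weak_star_top v.embed y G"
    by (rule v.dense_filter)
  note iff = iterated_limit_iff_ext
  show "(THE z. \<forall>F G. F \<noteq> bot \<longrightarrow> G \<noteq> bot \<longrightarrow>
      limitin u.weak_star_top u.embed x F \<longrightarrow> limitin v.weak_star_top v.embed y G \<longrightarrow>
      iterated_limit w.weak_star_top (\<lambda>a b. w.embed (m a b)) z F G) = ext x y"
    by (rule the_equality) (use F G iff in blast)+
  show "(THE z. \<forall>G F. G \<noteq> bot \<longrightarrow> F \<noteq> bot \<longrightarrow>
      limitin v.weak_star_top v.embed y G \<longrightarrow> limitin u.weak_star_top u.embed x F \<longrightarrow>
      iterated_limit w.weak_star_top (\<lambda>a b. w.embed (m a b)) z F G) = ext x y"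
    by (rule the_equality) (use F G iff in blast)+
qed

end

section \<open>Surjectivity of the second adjoint\<close>

text \<open>
  The first adjoint \<open>?D1\<close> is bounded below. Indeed, the functionals \<open>f\<close> with \<open>norm (?D1 f) \<le> 1\<close>
  are bounded at every point \<open>D a\<close>, since \<open>f (D a) = ?D1 f a\<close>, so the uniform boundedness
  principle applies to them. Hence an element \<open>h\<close> of the dual of \<open>Y1\<close> defines a bounded
  functional \<open>?D1 f \<mapsto> h f\<close> on the range of \<open>?D1\<close>, and an extension of it is a preimage of \<open>h\<close>.
  The hypothesis \<open>extend\<close> is the Hahn-Banach theorem, whose proof depends on the scalar field.
\<close>

lemma surj_second_adjoint:
  fixes sY :: "'k::real_normed_field \<Rightarrow> 'y::real_normed_vector \<Rightarrow> 'y"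
    and sY1 :: "'k \<Rightarrow> 'y1::real_normed_vector \<Rightarrow> 'y1"
    and sA1 :: "'k \<Rightarrow> 'a1::real_normed_vector \<Rightarrow> 'a1"
  assumes A1: "dual_space sA sA1 apA1 mkA1" and Y1: "dual_space sY sY1 apY1 mkY1"
    and Y2: "dual_space sY1 sY2 apY2 mkY2" and A2: "dual_space sA1 sA2 apA2 mkA2"
    and complete: "complete (UNIV :: 'y set)"
    and extend: "\<And>(T :: 'y1 \<Rightarrow> 'a1) \<phi> C. klinear sY1 sA1 T \<Longrightarrow> klinear sY1 (*) \<phi> \<Longrightarrow> 0 \<le> C \<Longrightarrow>
      (\<And>v. norm (\<phi> v) \<le> C * norm (T v)) \<Longrightarrow> \<exists>g. \<forall>v. apA2 g (T v) = \<phi> v"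
    and D: "klinear sA sY D" "surj D"
  shows "surj (dual_adjoint mkY2 apA2 (dual_adjoint mkA1 apY1 D))"
proof -
  interpret A1: dual_space sA sA1 apA1 mkA1 by fact
  interpret A2: dual_space sA1 sA2 apA2 mkA2 by fact
  interpret Y1: dual_space sY sY1 apY1 mkY1 by fact
  interpret Y2: dual_space sY1 sY2 apY2 mkY2 by fact
  let ?D1 = "dual_adjoint mkA1 apY1 D"
  have D1: "klinear sY1 sA1 ?D1"
    by (rule klinear_adjoint[OF A1 Y1 D(1)])
  have ap_D1: "apA1 (?D1 f) a = apY1 f (D a)" for f a
    by (rule ap_adjoint[OF A1 Y1 D(1)])
  interpret D1: bounded_linear ?D1 using D1 by (simp add: klinear_def)
  obtain K where K: "0 \<le> K" "\<And>f a. norm (apA1 f a) \<le> norm f * norm a * K"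
    using A1.ap.nonneg_bounded by blast
  let ?\<F> = "{apY1 f |f. norm (?D1 f) \<le> 1}"
  have "\<exists>L. \<forall>T\<in>?\<F>. norm (T y) \<le> L" for y
  proof -
    obtain a where a: "y = D a" using D(2) by (metis surjD)
    have "norm (apY1 f y) \<le> norm a * K" if "norm (?D1 f) \<le> 1" for f
    proof -
      have "norm (?D1 f) * norm a * K \<le> 1 * norm a * K"
        using that K(1) by (intro mult_right_mono) auto
      then show ?thesis using K(2)[of "?D1 f" a] by (simp add: a ap_D1)
    qed
    then show ?thesis by blast
  qed
  then obtain C where C: "0 \<le> C" "\<And>T y. T \<in> ?\<F> \<Longrightarrow> norm (T y) \<le> C * norm y"
    using uniform_boundedness[OF complete, of ?\<F>] Y1.ap.bounded_linear_right by blast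
  have "norm f \<le> C * norm (?D1 f)" for f
  proof (cases "?D1 f = 0")
    case True
    then have "apY1 f y = 0" for y
      using ap_D1[of f] D(2) by (metis A1.ap.zero_left surjD)
    then have "f = 0"
      by (intro Y1.ap_eqI) (simp add: Y1.ap.zero_left)
    then show ?thesis using C(1) by simp
  next
    case False
    let ?c = "inverse (norm (?D1 f))"
    have "norm (?D1 (?c *\<^sub>R f)) \<le> 1"
      using False by (simp add: D1.scaleR)
    then have "norm (?c *\<^sub>R f) \<le> C"
      by (intro Y1.dual_norm_le C) auto
    then show ?thesis using False by (simp add: field_simps)
  qed
  note D1_bound = this
  show ?thesis
    unfolding surj_def
  proof
    fix h
    obtain L where L: "0 \<le> L" "\<And>f. norm (apY2 h f) \<le> norm f * L"
      using bounded_linear.nonneg_bounded[OF Y2.ap.bounded_linear_right] by blast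
    have "norm (apY2 h f) \<le> (C * L) * norm (?D1 f)" for f
      using order_trans[OF L(2) mult_right_mono[OF D1_bound L(1)]] by (simp add: mult_ac)
    then obtain g where g: "\<And>f. apA2 g (?D1 f) = apY2 h f"
      using extend[OF D1 Y2.ap_linear_right] C(1) L(1) by (metis mult_nonneg_nonneg)
    then have "h = dual_adjoint mkY2 apA2 ?D1 g"
      by (intro Y2.ap_eqI) (simp add: ap_adjoint[OF Y2 A2 D1])
    then show "\<exists>g. h = dual_adjoint mkY2 apA2 ?D1 g" by blast
  qed
qed

section \<open>The continuity argument\<close>

text \<open>
  Spaces \<open>A\<close> and \<open>X\<close> with their biduals and the third dual of \<open>X\<close>, a bilinear multiplication and
  bilinear actions, extended to the biduals. The map \<open>D\<close> takes values in the dual of \<open>X\<close>, and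
  the Leibniz rule is imposed later, on its second adjoint \<open>D2\<close>.
\<close>

locale bidual_action =
  a: bidual_space sa sa1 sa2 apa1 mka1 apa2 mka2 +
  x: bidual_space sx sx1 sx2 apx1 mkx1 apx2 mkx2 +
  x3: dual_space sx2 sx3 apx3 mkx3 +
  mult: bidual_bilinear sa sa1 sa2 apa1 mka1 apa2 mka2 sa sa1 sa2 apa1 mka1 apa2 mka2
    sa sa1 sa2 apa1 mka1 apa2 mka2 mult +
  left: bidual_bilinear sa sa1 sa2 apa1 mka1 apa2 mka2 sx sx1 sx2 apx1 mkx1 apx2 mkx2
    sx sx1 sx2 apx1 mkx1 apx2 mkx2 l +
  right: bidual_bilinear sx sx1 sx2 apx1 mkx1 apx2 mkx2 sa sa1 sa2 apa1 mka1 apa2 mka2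
    sx sx1 sx2 apx1 mkx1 apx2 mkx2 r
  for sa :: "'k::real_normed_field \<Rightarrow> 'a::real_normed_vector \<Rightarrow> 'a"
    and sa1 :: "'k \<Rightarrow> 'a1::real_normed_vector \<Rightarrow> 'a1"
    and sa2 :: "'k \<Rightarrow> 'a2::real_normed_vector \<Rightarrow> 'a2"
    and apa1 mka1 apa2 mka2
    and sx :: "'k \<Rightarrow> 'x::real_normed_vector \<Rightarrow> 'x"
    and sx1 :: "'k \<Rightarrow> 'x1::real_normed_vector \<Rightarrow> 'x1"
    and sx2 :: "'k \<Rightarrow> 'x2::real_normed_vector \<Rightarrow> 'x2"
    and apx1 mkx1 apx2 mkx2
    and sx3 :: "'k \<Rightarrow> 'x3::real_normed_vector \<Rightarrow> 'x3"
    and apx3 mkx3 mult l r +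
  fixes D :: "'a \<Rightarrow> 'x1"
  assumes D: "klinear sa sx1 D"
begin

definition D1 :: "'x2 \<Rightarrow> 'a1" where "D1 = dual_adjoint mka1 apx2 D"

definition D2 :: "'a2 \<Rightarrow> 'x3" where "D2 = dual_adjoint mkx3 apa2 D1"

lemma D1_linear: "klinear sx2 sa1 D1"
  unfolding D1_def by (rule klinear_adjoint[OF a.d1.dual_space_axioms x.d2.dual_space_axioms D])

lemma ap_D2: "apx3 (D2 z) y = apa2 z (D1 y)"
  unfolding D2_def by (rule ap_adjoint[OF x3.dual_space_axioms a.d2.dual_space_axioms D1_linear])

definition lact :: "'a2 \<Rightarrow> 'x3 \<Rightarrow> 'x3" where
  "lact b h = mkx3 (\<lambda>y. apx3 h (right.ext y b))"

definition ract :: "'x3 \<Rightarrow> 'a2 \<Rightarrow> 'x3" where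
  "ract h b = mkx3 (\<lambda>y. apx3 h (left.ext b y))"

lemma ap_lact: "apx3 (lact b h) y = apx3 h (right.ext y b)"
  unfolding lact_def using klinear_compose[OF kbilinear_left[OF right.ext_bilinear] x3.ap_linear_right]
  by (simp add: x3.ap_mk)

lemma ap_ract: "apx3 (ract h b) y = apx3 h (left.ext b y)"
  unfolding ract_def using klinear_compose[OF kbilinear_right[OF left.ext_bilinear] x3.ap_linear_right]
  by (simp add: x3.ap_mk)

text \<open>
  Weak continuity has to be tested against all functionals \<open>h\<close> on \<open>X**\<close>, and every one is \<open>D2 b\<close>
  for some \<open>b\<close>. The Leibniz rule then writes \<open>z \<mapsto> h (y z)\<close> as the difference of \<open>z \<mapsto> D2 (z b) y\<close>
  and \<open>z \<mapsto> (D2 z \<cdot> b) y = D2 z (b y)\<close>. Both are evaluations of \<open>z\<close> at an element of \<open>A*\<close>: the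
  first Arens product is weak* continuous in its left factor, and \<open>D2\<close> is weak* continuous.
\<close>

lemma right_ext_weakly_continuous:
  assumes complete: "complete (UNIV :: 'x1 set)"
    and extend: "\<And>(T :: 'x2 \<Rightarrow> 'a1) \<phi> C. klinear sx2 sa1 T \<Longrightarrow> klinear sx2 (*) \<phi> \<Longrightarrow> 0 \<le> C \<Longrightarrow>
      (\<And>v. norm (\<phi> v) \<le> C * norm (T v)) \<Longrightarrow> \<exists>g. \<forall>v. apa2 g (T v) = \<phi> v"
    and "surj D" and D2: "leibniz mult.ext lact ract D2"
  shows "continuous_map a.weak_star_top (pullback_topology UNIV (\<lambda>y h. apx3 h y) euclidean) (right.ext y)"
proof (rule continuous_map_pullback_euclidean)
  fix h
  have "surj D2"
    unfolding D2_def D1_def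
    by (rule surj_second_adjoint[OF a.d1.dual_space_axioms x.d2.dual_space_axioms x3.dual_space_axioms
          a.d2.dual_space_axioms complete extend D \<open>surj D\<close>])
  then obtain b where h: "h = D2 b" by (metis surjD)
  have "apx3 h (right.ext y z) = apa2 z (mult.adj2 b (D1 y) - D1 (left.ext b y))" for z
  proof -
    have "apx3 h (right.ext y z) = apx3 (lact z (D2 b)) y"
      by (simp add: h ap_lact)
    also have "\<dots> = apx3 (D2 (mult.ext z b) - ract (D2 z) b) y"
      using D2 by (simp add: leibniz_def)
    also have "\<dots> = apa2 z (mult.adj2 b (D1 y)) - apa2 z (D1 (left.ext b y))"
      by (simp add: x3.ap.diff_left ap_ract ap_D2 mult.ap_ext)
    finally show ?thesis by (simp add: a.d2.ap.diff_right)
  qed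
  then show "\<exists>g. \<forall>z. apx3 h (right.ext y z) = apa2 z g" by blast
qed

end

section \<open>Real scalars\<close>

lemma real_dual_space: "dual_space (*\<^sub>R) (*\<^sub>R) blinfun_apply Blinfun"
proof
  show "kbilinear (*\<^sub>R) (*\<^sub>R) (*) (blinfun_apply :: (_ \<Rightarrow>\<^sub>L real) \<Rightarrow> _)"
    by (simp add: kbilinear_def bounded_bilinear_blinfun_apply blinfun.scaleR_left blinfun.scaleR_right)
qed (auto simp: klinear_def bounded_linear_Blinfun_apply intro: blinfun_eqI norm_blinfun_bound)

lemma real_extension:
  fixes T :: "'v::real_normed_vector \<Rightarrow> 'w::real_normed_vector"
  assumes "klinear (*\<^sub>R) (*\<^sub>R) T" "klinear (*\<^sub>R) (*) \<phi>" "0 \<le> C" "\<And>v. norm (\<phi> v) \<le> C * norm (T v)"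
  shows "\<exists>g. \<forall>v. blinfun_apply g (T v) = \<phi> v"
proof -
  have "linear T" "linear \<phi>"
    using assms by (auto simp: klinear_def bounded_linear.linear)
  then obtain g where "bounded_linear g" "\<And>v. g (T v) = \<phi> v"
    using hahn_banach_factor[of T \<phi> C] assms(3,4) by auto
  then show ?thesis
    by (intro exI[of _ "Blinfun g"]) (simp add: bounded_linear_Blinfun_apply)
qed

lemma bidual_ract_weakly_continuous:
  fixes l :: "'a::{real_normed_algebra,banach} \<Rightarrow> 'x::banach \<Rightarrow> 'x"
    and D :: "'a \<Rightarrow> ('x \<Rightarrow>\<^sub>L real)"
  assumes mod: "banach_bimodule l r" and D: "derivation (*) (dual_lact r) (dual_ract l) D" "surj D"
    and D2: "derivation arens_mult (dual_lact (bidual_ract r)) (dual_ract (bidual_lact l))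
        (adjoint_map (adjoint_map D))"
  shows "continuous_map weak_star weak_topology (bidual_ract r x'')"
proof -
  have bil: "kbilinear (*\<^sub>R) (*\<^sub>R) (*\<^sub>R) B" if "bounded_bilinear B" for B :: "'u::real_normed_vector \<Rightarrow> 'v::real_normed_vector \<Rightarrow> 'w::real_normed_vector"
    using that by (simp add: kbilinear_def bounded_bilinear.scaleR_left bounded_bilinear.scaleR_right)
  interpret bidual_action "(*\<^sub>R)" "(*\<^sub>R)" "(*\<^sub>R)" blinfun_apply Blinfun blinfun_apply Blinfun
    "(*\<^sub>R)" "(*\<^sub>R)" "(*\<^sub>R)" blinfun_apply Blinfun blinfun_apply Blinfun "(*\<^sub>R)" blinfun_apply Blinfun
    "(*)" l r D
    using mod D
    by (auto intro!: bidual_action.intro bidual_space.intro bidual_bilinear.intro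
        bidual_bilinear_axioms.intro bidual_action_axioms.intro real_dual_space bil bounded_bilinear_mult
        simp: banach_bimodule_def derivation_def klinear_def linear_cmul bounded_linear.linear)
  have canon: "a.embed = canon" "x.embed = canon"
    by (simp_all add: fun_eq_iff a.embed_def x.embed_def canon_def)
  have ext: "bidual_ract r = right.ext" "bidual_lact l = left.ext" "arens_mult = mult.ext"
    using left.THE_iterated_limit(1) right.THE_iterated_limit(2)
    by (simp_all add: fun_eq_iff bidual_ract_def bidual_lact_def strong_operator_topology_def canon
        arens_mult_def arens_left_def dual_ract_def mult.ext_def mult.adj2_def mult.adj1_def
        bilinear_adjoint_def)
  have "adjoint_map (adjoint_map D) = D2" "dual_lact right.ext = lact" "dual_ract left.ext = ract"
    by (simp_all add: fun_eq_iff adjoint_map_def D2_def D1_def dual_adjoint_def dual_lact_def lact_def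
        dual_ract_def ract_def)
  then have "leibniz mult.ext lact ract D2"
    using D2 by (simp add: derivation_def ext)
  from right_ext_weakly_continuous[OF complete_UNIV real_extension \<open>surj D\<close> this] show ?thesis
    by (simp add: strong_operator_topology_def weak_topology_def ext)
qed

section \<open>Complex scalars\<close>

lemma cdual_apply_Cdual:
  assumes "klinear (*\<^sub>C) (*) \<phi>" shows "cdual_apply (Cdual \<phi>) = \<phi>"
  using assms unfolding klinear_def Cdual_def cdual_apply.rep_eq
  by (subst cdual_of_blinfun_inverse) (auto simp: bounded_linear_Blinfun_apply)

lemma complex_dual_space: "dual_space (*\<^sub>C) (*\<^sub>C) cdual_apply Cdual"
proof (rule dual_space.intro)
  show "kbilinear (*\<^sub>C) (*\<^sub>C) (*) cdual_apply"
    unfolding kbilinear_def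
  proof (intro conjI allI bounded_bilinear.intro)
    show "\<exists>K. \<forall>f v. norm (cdual_apply f v) \<le> norm f * norm v * K"
      by (rule exI[of _ 1], transfer) (simp add: norm_blinfun)
  qed (transfer; simp add: blinfun.add_left blinfun.add_right blinfun.scaleR_left blinfun.scaleR_right)+
  show "f = g" if "\<And>v. cdual_apply f v = cdual_apply g v" for f g
    using that by transfer (rule blinfun_eqI)
  show "norm f \<le> C" if "0 \<le> C" "\<And>v. norm (cdual_apply f v) \<le> C * norm v" for f C
    using that by transfer (rule norm_blinfun_bound)
qed (rule cdual_apply_Cdual)

text \<open>
  The complex linear functionals are closed in the complete space of bounded real linear maps
  into the complex numbers.
\<close>

lemma complete_cdual: "complete (UNIV :: 'v::complex_normed_vector cdual set)"
  unfolding complete_def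
proof (intro allI impI, elim conjE)
  fix f :: "nat \<Rightarrow> 'v cdual" assume "Cauchy f"
  then have "Cauchy (\<lambda>n. blinfun_of_cdual (f n))"
    by (simp add: Cauchy_def dist_norm norm_cdual.rep_eq minus_cdual.rep_eq)
  then obtain g where g: "(\<lambda>n. blinfun_of_cdual (f n)) \<longlonglongrightarrow> g"
    by (meson Cauchy_convergent convergentD)
  have "blinfun_apply g (c *\<^sub>C v) = c * blinfun_apply g v" for c v
  proof (rule LIMSEQ_unique)
    show "(\<lambda>n. blinfun_apply (blinfun_of_cdual (f n)) (c *\<^sub>C v)) \<longlonglongrightarrow> blinfun_apply g (c *\<^sub>C v)"
      by (intro tendsto_intros g)
    have "(\<lambda>n. c * blinfun_apply (blinfun_of_cdual (f n)) v) \<longlonglongrightarrow> c * blinfun_apply g v"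
      by (intro tendsto_intros g)
    moreover have "blinfun_apply (blinfun_of_cdual (f n)) (c *\<^sub>C v) = c * blinfun_apply (blinfun_of_cdual (f n)) v" for n
      using blinfun_of_cdual[of "f n"] by blast
    ultimately show "(\<lambda>n. blinfun_apply (blinfun_of_cdual (f n)) (c *\<^sub>C v)) \<longlonglongrightarrow> c * blinfun_apply g v"
      by simp
  qed
  then have "blinfun_of_cdual (cdual_of_blinfun g) = g"
    by (intro cdual_of_blinfun_inverse) auto
  with g have "f \<longlonglongrightarrow> cdual_of_blinfun g"
    by (simp add: LIMSEQ_iff norm_cdual.rep_eq minus_cdual.rep_eq)
  then show "\<exists>h\<in>UNIV. f \<longlonglongrightarrow> h" by blast
qed

text \<open>
  A complex functional is determined by its real part \<open>u\<close> as \<open>g w = u w - \<i> * u (\<i> w)\<close>, so it is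
  enough to extend the real part of \<open>\<phi>\<close>.
\<close>

lemma complex_extension:
  fixes T :: "'v::complex_normed_vector \<Rightarrow> 'w::complex_normed_vector"
  assumes T: "klinear (*\<^sub>C) (*\<^sub>C) T" and \<phi>: "klinear (*\<^sub>C) (*) \<phi>"
    and "0 \<le> C" and bound: "\<And>v. norm (\<phi> v) \<le> C * norm (T v)"
  shows "\<exists>g. \<forall>v. cdual_apply g (T v) = \<phi> v"
proof -
  have lin: "linear T" "bounded_linear \<phi>"
    using T \<phi> by (auto simp: klinear_def bounded_linear.linear)
  have "linear (\<lambda>v. Re (\<phi> v))"
    using lin(2) by (intro bounded_linear.linear bounded_linear_compose[OF bounded_linear_Re])
  moreover have "\<bar>Re (\<phi> v)\<bar> \<le> C * norm (T v)" for v
    using abs_Re_le_cmod bound by (rule order_trans)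
  ultimately obtain u where u: "bounded_linear u" and uT: "\<And>v. u (T v) = Re (\<phi> v)"
    using hahn_banach_factor[OF lin(1) _ _ \<open>0 \<le> C\<close>] by blast
  interpret u: bounded_linear u by fact
  define g where "g w = complex_of_real (u w) - \<i> * complex_of_real (u (\<i> *\<^sub>C w))" for w
  have scaleR: "r *\<^sub>R w = complex_of_real r *\<^sub>C w" for r and w :: 'w
    by (simp add: scaleC_of_real)
  have i: "bounded_linear (\<lambda>w :: 'w. \<i> *\<^sub>C w)"
    by (rule bounded_linear_intro[of _ 1])
      (simp_all add: scaleC_add_right norm_scaleC scaleR scaleC_scaleC mult.commute)
  have "bounded_linear g"
    unfolding g_def
    by (intro bounded_linear_sub bounded_linear_const_mult bounded_linear_compose[OF bounded_linear_of_real]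
        bounded_linear_compose[OF u i] u)
  moreover have "g (c *\<^sub>C w) = c * g w" for c w
  proof -
    have split: "u (c *\<^sub>C w) = Re c * u w + Im c * u (\<i> *\<^sub>C w)" for c w
    proof -
      have "c *\<^sub>C w = Re c *\<^sub>R w + Im c *\<^sub>R (\<i> *\<^sub>C w)"
        unfolding scaleR scaleC_scaleC scaleC_add_left[symmetric]
        by (rule arg_cong[where f="\<lambda>c. c *\<^sub>C w"]) (simp add: complex_eq_iff)
      then show ?thesis by (simp add: u.add u.scaleR)
    qed
    show ?thesis
      unfolding g_def scaleC_scaleC split[of c] split[of "\<i> * c"]
      by (simp add: complex_eq_iff)
  qed
  ultimately have g: "klinear (*\<^sub>C) (*) g" by (simp add: klinear_def)
  have "g (T v) = \<phi> v" for v
  proof -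
    have "\<i> *\<^sub>C T v = T (\<i> *\<^sub>C v)" "\<phi> (\<i> *\<^sub>C v) = \<i> * \<phi> v"
      using T \<phi> by (auto simp: klinear_def)
    then show ?thesis by (simp add: g_def uT complex_eq_iff)
  qed
  then show ?thesis
    by (intro exI[of _ "Cdual g"]) (simp add: cdual_apply_Cdual[OF g])
qed

lemma cbidual_ract_weakly_continuous:
  fixes l :: "'a::{complex_normed_algebra,banach} \<Rightarrow> 'x::{complex_normed_vector,banach} \<Rightarrow> 'x"
    and D :: "'a \<Rightarrow> 'x cdual"
  assumes mod: "cbanach_bimodule l r" and D: "cderivation (*) (cdual_lact r) (cdual_ract l) D" "surj D"
    and D2: "cderivation carens_mult (cdual_lact (cbidual_ract r)) (cdual_ract (cbidual_lact l))
        (cadjoint_map (cadjoint_map D))"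
  shows "continuous_map cweak_star cweak_topology (cbidual_ract r x'')"
proof -
  have bil: "kbilinear (*\<^sub>C) (*\<^sub>C) (*\<^sub>C) ((*) :: 'a \<Rightarrow> _)"
    by (simp add: kbilinear_def bounded_bilinear_mult mult_scaleC_left mult_scaleC_right)
  interpret bidual_action "(*\<^sub>C)" "(*\<^sub>C)" "(*\<^sub>C)" cdual_apply Cdual cdual_apply Cdual
    "(*\<^sub>C)" "(*\<^sub>C)" "(*\<^sub>C)" cdual_apply Cdual cdual_apply Cdual "(*\<^sub>C)" cdual_apply Cdual
    "(*)" l r D
    using mod D
    by (auto intro!: bidual_action.intro bidual_space.intro bidual_bilinear.intro
        bidual_bilinear_axioms.intro bidual_action_axioms.intro complex_dual_space bil
        simp: cbanach_bimodule_def bounded_cbilinear_def kbilinear_def cderivation_def bounded_clinear_def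
          klinear_def)
  have canon: "a.embed = ccanon" "x.embed = ccanon"
    by (simp_all add: fun_eq_iff a.embed_def x.embed_def ccanon_def)
  have ext: "cbidual_ract r = right.ext" "cbidual_lact l = left.ext" "carens_mult = mult.ext"
    using left.THE_iterated_limit(1) right.THE_iterated_limit(2)
    by (simp_all add: fun_eq_iff cbidual_ract_def cbidual_lact_def cweak_star_def canon
        carens_mult_def carens_left_def cdual_ract_def mult.ext_def mult.adj2_def mult.adj1_def
        bilinear_adjoint_def)
  have "cadjoint_map (cadjoint_map D) = D2" "cdual_lact right.ext = lact" "cdual_ract left.ext = ract"
    by (simp_all add: fun_eq_iff cadjoint_map_def D2_def D1_def dual_adjoint_def cdual_lact_def lact_def
        cdual_ract_def ract_def)
  then have "leibniz mult.ext lact ract D2"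
    using D2 by (simp add: cderivation_def ext)
  from right_ext_weakly_continuous[OF complete_cdual complex_extension \<open>surj D\<close> this] show ?thesis
    by (simp add: cweak_star_def cweak_topology_def ext)
qed

section \<open>Weak*-to-weak continuity of the right action\<close>

theorem mainTheorem4:
  fixes l :: "'a::{real_normed_algebra,banach} \<Rightarrow> 'x::banach \<Rightarrow> 'x"
    and r :: "'x \<Rightarrow> 'a \<Rightarrow> 'x"
    and D :: "'a \<Rightarrow> ('x \<Rightarrow>\<^sub>L real)"
    and lc :: "'b::{complex_normed_algebra,banach} \<Rightarrow> 'y::{complex_normed_vector,banach} \<Rightarrow> 'y"
    and rc :: "'y \<Rightarrow> 'b \<Rightarrow> 'y"
    and Dc :: "'b \<Rightarrow> 'y cdual"
  shows
    "(banach_bimodule l r \<and>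
      derivation (*) (dual_lact r) (dual_ract l) D \<and> surj D \<and>
      derivation arens_mult (dual_lact (bidual_ract r)) (dual_ract (bidual_lact l))
        (adjoint_map (adjoint_map D))
      \<longrightarrow> (\<forall>x''. continuous_map weak_star weak_topology (\<lambda>a''. bidual_ract r x'' a'')))
   \<and> (cbanach_bimodule lc rc \<and>
      cderivation (*) (cdual_lact rc) (cdual_ract lc) Dc \<and> surj Dc \<and>
      cderivation carens_mult (cdual_lact (cbidual_ract rc)) (cdual_ract (cbidual_lact lc))
        (cadjoint_map (cadjoint_map Dc))
      \<longrightarrow> (\<forall>x''. continuous_map cweak_star cweak_topology (\<lambda>a''. cbidual_ract rc x'' a'')))"
  by (intro conjI impI allI; elim conjE;
      rule bidual_ract_weakly_continuous cbidual_ract_weakly_continuous)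

end
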